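(* Let $$\phi(x,y)=(x_d-y_d)-(x_1-y_1)^2-\dots-(x_{d-1}-y_{d-1})^2\qquad(x,y\in\mathbb{R}^d),$$ and let $\alpha_1=\dots=\alpha_{d-1}=\frac{d}{d+1}$ and $\alpha_d=\beta=\frac{2d}{d+1}$. Then $$q^{-d}\,\#\{(n,m)\in\mathbb{Z}^d\times\mathbb{Z}^d:\ |n_j|,|m_j|\le Cq^{\alpha_j}\ \text{for all }j;\ \phi(n,m)=q^{\frac{2d}{d+1}}\}\approx q^{d-2+\frac{2}{d+1}},$$ and thus the bound $(\dagger)$ recalled in the context is, in general, sharp.
   Context: Here $d\ge2$, $C$ is a positive constant dependent on $\phi$, and $X\approx Y$ means that $X$ and $Y$ are comparable up to constants independent of $q$ (and $X\lesssim Y$ is the corresponding one-sided bound). The bound whose sharpness is asserted is the following. Let $\phi:\mathbb{R}^d\times\mathbb{R}^d\to\mathbb{R}$ be $C^{\lfloor d/2\rfloor+1}$ away from the origin, with $\phi(q^{\alpha_1}x_1,\dots,q^{\alpha_d}x_d,q^{\alpha_1}y_1,\dots,q^{\alpha_d}y_d)=q^{\beta}\phi(x,y)$, where $\sum_{j}\alpha_j=d$, $\alpha_j\le\frac{2d}{d+1}$ and $\alpha_j,\beta>0$. Let $B$ be the unit ball. Suppose that $\nabla_x\phi\ne0$ and $\nabla_y\phi\ne0$ in a neighborhood of the sets $\{x\in B:\phi(x,y)=t\}$, $\{y\in B:\phi(x,y)=t\}$, and that the Monge-Ampere determinant $\det\begin{pmatrix}0&\nabla_x\phi\\-(\nabla_y\phi)^T&\frac{\partial^2\phi}{\partial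 x_i\partial y_j}\end{pmatrix}$ does not vanish on $\{(x,y)\in B\times B:\phi(x,y)=t\}$ for any $t>0$. Then $$(\dagger)\qquad q^{-d}\,\#\{(n,m)\in\mathbb{Z}^d\times\mathbb{Z}^d:\ |n_j|,|m_j|\le Cq^{\alpha_j}\ \text{for all }j;\ |\phi(n,m)-q^\beta|\le\delta\}\lesssim\max\{q^{d-2+\frac{2}{d+1}},\,q^{d-\beta}\delta\}$$ for a positive constant $C$ dependent on $\phi$.
   Formalization: The lower bound in ≈ is asserted only for q ≥ 1 with q^{2d/(d+1)} an integer, since otherwise no lattice pair satisfies φ(n,m) = q^{2d/(d+1)} and the count is 0; C is taken to be any sufficiently large constant. *)

theory Defs
  imports "HOL-Analysis.Analysis"
begin

text \<open>
  Vectors in R^d are elements of \<open>real ^ 'd\<close> with \<open>d = CARD('d)\<close>.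
  A function on R^d x R^d is written in curried form.
\<close>

text \<open>
  Continuous differentiability of order \<open>k\<close>, to be used for open sets \<open>S\<close> only: for a
  set that is not open the full derivative at a point of \<open>S\<close> looks outside \<open>S\<close>.
\<close>

primrec Ck_on :: "nat \<Rightarrow> ('a::euclidean_space \<Rightarrow> real) \<Rightarrow> 'a set \<Rightarrow> bool" where
  "Ck_on 0 f S \<longleftrightarrow> continuous_on S f"
| "Ck_on (Suc k) f S \<longleftrightarrow>
     (\<forall>x\<in>S. f differentiable (at x)) \<and>
     (\<forall>b\<in>Basis. Ck_on k (\<lambda>x. frechet_derivative f (at x) b) S)"

definition partial :: "'d::finite \<Rightarrow> (real ^ 'd \<Rightarrow> real) \<Rightarrow> real ^ 'd \<Rightarrow> real" where
  "partial i f x = deriv (\<lambda>s. f (x + s *\<^sub>R axis i 1)) 0"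

definition grad_x :: "(real ^ 'd \<Rightarrow> real ^ 'd \<Rightarrow> real) \<Rightarrow> real ^ 'd \<Rightarrow> real ^ 'd \<Rightarrow> real ^ ('d::finite)" where
  "grad_x \<phi> x y = (\<chi> i. partial i (\<lambda>u. \<phi> u y) x)"

definition grad_y :: "(real ^ 'd \<Rightarrow> real ^ 'd \<Rightarrow> real) \<Rightarrow> real ^ 'd \<Rightarrow> real ^ 'd \<Rightarrow> real ^ ('d::finite)" where
  "grad_y \<phi> x y = (\<chi> i. partial i (\<lambda>v. \<phi> x v) y)"

definition mixed_hessian :: "(real ^ 'd \<Rightarrow> real ^ 'd \<Rightarrow> real) \<Rightarrow> real ^ 'd \<Rightarrow> real ^ 'd \<Rightarrow> real ^ 'd ^ ('d::finite)" where
  "mixed_hessian \<phi> x y = (\<chi> i j. partial i (\<lambda>u. partial j (\<lambda>v. \<phi> u v) y) x)"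

text \<open>
  The bordered (d+1) x (d+1) matrix; \<open>None\<close> is the index of the border row and column.
\<close>

definition monge_ampere_matrix ::
    "(real ^ 'd \<Rightarrow> real ^ 'd \<Rightarrow> real) \<Rightarrow> real ^ 'd \<Rightarrow> real ^ 'd \<Rightarrow> real ^ ('d option) ^ (('d::finite) option)" where
  "monge_ampere_matrix \<phi> x y =
     (\<chi> r c. case r of
         None \<Rightarrow> (case c of None \<Rightarrow> 0 | Some j \<Rightarrow> grad_x \<phi> x y $ j)
       | Some i \<Rightarrow> (case c of None \<Rightarrow> - (grad_y \<phi> x y $ i) | Some j \<Rightarrow> mixed_hessian \<phi> x y $ i $ j))"

definition dilate :: "('d \<Rightarrow> real) \<Rightarrow> real \<Rightarrow> real ^ 'd \<Rightarrow> real ^ ('d::finite)" where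
  "dilate \<alpha> q x = (\<chi> j. q powr \<alpha> j * x $ j)"

definition admissible :: "(real ^ 'd \<Rightarrow> real ^ 'd \<Rightarrow> real) \<Rightarrow> ('d::finite \<Rightarrow> real) \<Rightarrow> real \<Rightarrow> bool" where
  "admissible \<phi> \<alpha> \<beta> \<longleftrightarrow>
     Ck_on (CARD('d) div 2 + 1) (\<lambda>(x, y). \<phi> x y) (UNIV - {0}) \<and>
     (\<forall>q>0. \<forall>x y. \<phi> (dilate \<alpha> q x) (dilate \<alpha> q y) = q powr \<beta> * \<phi> x y) \<and>
     (\<Sum>j\<in>UNIV. \<alpha> j) = real CARD('d) \<and>
     (\<forall>j. 0 < \<alpha> j \<and> \<alpha> j \<le> 2 * real CARD('d) / (real CARD('d) + 1)) \<and>
     0 < \<beta> \<and>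
     (\<forall>t>0. \<forall>y\<in>cball 0 1. \<exists>U. open U \<and> {x \<in> cball 0 1. \<phi> x y = t} \<subseteq> U \<and>
        (\<forall>x\<in>U. grad_x \<phi> x y \<noteq> 0 \<and> grad_y \<phi> x y \<noteq> 0)) \<and>
     (\<forall>t>0. \<forall>x\<in>cball 0 1. \<exists>U. open U \<and> {y \<in> cball 0 1. \<phi> x y = t} \<subseteq> U \<and>
        (\<forall>y\<in>U. grad_x \<phi> x y \<noteq> 0 \<and> grad_y \<phi> x y \<noteq> 0)) \<and>
     (\<forall>t>0. \<forall>x\<in>cball 0 1. \<forall>y\<in>cball 0 1.
        \<phi> x y = t \<longrightarrow> det (monge_ampere_matrix \<phi> x y) \<noteq> 0)"

definition lattice_point :: "int ^ 'd \<Rightarrow> real ^ ('d::finite)" where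
  "lattice_point n = (\<chi> j. real_of_int (n $ j))"

definition lattice_box :: "('d \<Rightarrow> real) \<Rightarrow> real \<Rightarrow> real \<Rightarrow> (int ^ ('d::finite)) set" where
  "lattice_box \<alpha> C q = {n. \<forall>j. \<bar>real_of_int (n $ j)\<bar> \<le> C * q powr \<alpha> j}"

definition exact_count ::
    "(real ^ 'd \<Rightarrow> real ^ 'd \<Rightarrow> real) \<Rightarrow> ('d::finite \<Rightarrow> real) \<Rightarrow> real \<Rightarrow> real \<Rightarrow> real \<Rightarrow> nat" where
  "exact_count \<phi> \<alpha> \<beta> C q =
     card {(n, m). n \<in> lattice_box \<alpha> C q \<and> m \<in> lattice_box \<alpha> C q \<and>
                   \<phi> (lattice_point n) (lattice_point m) = q powr \<beta>}"

definition near_count ::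
    "(real ^ 'd \<Rightarrow> real ^ 'd \<Rightarrow> real) \<Rightarrow> ('d::finite \<Rightarrow> real) \<Rightarrow> real \<Rightarrow> real \<Rightarrow> real \<Rightarrow> real \<Rightarrow> nat" where
  "near_count \<phi> \<alpha> \<beta> C q \<delta> =
     card {(n, m). n \<in> lattice_box \<alpha> C q \<and> m \<in> lattice_box \<alpha> C q \<and>
                   \<bar>\<phi> (lattice_point n) (lattice_point m) - q powr \<beta>\<bar> \<le> \<delta>}"

text \<open>
  The upper bound for \<open>near_count\<close>, with an arbitrary exponent \<open>\<gamma>\<close> in place of
  \<open>d - 2 + 2 / (d + 1)\<close>.
\<close>

definition lattice_bound ::
    "(real ^ 'd \<Rightarrow> real ^ 'd \<Rightarrow> real) \<Rightarrow> ('d::finite \<Rightarrow> real) \<Rightarrow> real \<Rightarrow> real \<Rightarrow> real \<Rightarrow> bool" where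
  "lattice_bound \<phi> \<alpha> \<beta> C \<gamma> \<longleftrightarrow>
     (\<exists>K>0. \<forall>q\<ge>1. \<forall>\<delta>>0.
        q powr (- real CARD('d)) * real (near_count \<phi> \<alpha> \<beta> C q \<delta>)
          \<le> K * max (q powr \<gamma>) (q powr (real CARD('d) - \<beta>) * \<delta>))"

end

theory Submission
  imports Defs
begin

text \<open>The equation \<open>\<phi>(n, m) = q powr \<beta>\<close> determines \<open>n $ l\<close> from \<open>m\<close> and the other coordinates of
  \<open>n\<close>, and when \<open>q powr \<beta>\<close> is an integer the value so obtained is an integer of admissible size. Hence
  the solutions number about \<open>q powr (2 * d - \<beta>)\<close>, and \<open>d - \<beta> = d - 2 + 2 / (d + 1)\<close>.\<close>

section \<open>Smoothness of polynomials\<close>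

text \<open>A linear function has constant derivative, and the sum and product rules keep
  derivatives polynomial. Differentiability is carried along because those two rules require it of
  both operands. Closure under derivatives is what the recursion of \<open>Ck_on\<close>
  consumes.\<close>

lemma real_polynomial_function_frechet_derivative:
  fixes f :: "'a::euclidean_space \<Rightarrow> real"
  assumes "real_polynomial_function f"
  shows "f differentiable (at x) \<and> real_polynomial_function (\<lambda>x. frechet_derivative f (at x) b)"
  using assms
proof (induction arbitrary: x)
  case (linear h)
  have "frechet_derivative h (at y) = h" for y
    using linear by (metis bounded_linear_imp_has_derivative frechet_derivative_at)
  then show ?case
    using linear by (auto intro: real_polynomial_function.intros bounded_linear_imp_differentiable)
next
  case (const c)
  then show ?case
    by (auto intro: real_polynomial_function.intros)
next
  case (add f g)
  have "frechet_derivative (\<lambda>y. f y + g y) (at y) b =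
      frechet_derivative f (at y) b + frechet_derivative g (at y) b" for y
  proof -
    have "((\<lambda>y. f y + g y) has_derivative
        (\<lambda>h. frechet_derivative f (at y) h + frechet_derivative g (at y) h)) (at y)"
      using add.IH by (intro has_derivative_add) (simp_all add: frechet_derivative_works[symmetric])
    from fun_cong[OF frechet_derivative_at[OF this], of b] show ?thesis
      by simp
  qed
  with add.IH show ?case
    by (auto intro: real_polynomial_function.intros)
next
  case (mult f g)
  have "frechet_derivative (\<lambda>y. f y * g y) (at y) b =
      f y * frechet_derivative g (at y) b + frechet_derivative f (at y) b * g y" for y
  proof -
    have "((\<lambda>y. f y * g y) has_derivative
        (\<lambda>h. f y * frechet_derivative g (at y) h + frechet_derivative f (at y) h * g y)) (at y)"
      using mult.IH by (intro has_derivative_mult) (simp_all add: frechet_derivative_works[symmetric])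
    from fun_cong[OF frechet_derivative_at[OF this], of b] show ?thesis
      by simp
  qed
  moreover have "real_polynomial_function (\<lambda>y. f y * frechet_derivative g (at y) b +
      frechet_derivative f (at y) b * g y)"
    using mult by (intro real_polynomial_function.intros(3,4)) simp_all
  ultimately show ?case
    using mult.IH by auto
qed

lemma Ck_on_real_polynomial_function:
  assumes "real_polynomial_function f"
  shows "Ck_on k f S"
  using assms
proof (induction k arbitrary: f)
  case 0
  then show ?case
    by (simp add: continuous_on_polymonial_function real_polynomial_function_eq)
next
  case (Suc k)
  then show ?case
    using real_polynomial_function_frechet_derivative by auto
qed

section \<open>The paraboloid: derivatives and Monge-Ampere determinant\<close>

text \<open>The index type is unordered, so the arbitrary index \<open>l\<close> takes the place of
  the last coordinate.\<close>

definition paraboloid :: "'d \<Rightarrow> real ^ 'd \<Rightarrow> real ^ 'd \<Rightarrow> real" where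
  "paraboloid l x y = (x $ l - y $ l) - (\<Sum>j\<in>UNIV - {l}. (x $ j - y $ j)\<^sup>2)"

lemma Ck_on_paraboloid: "Ck_on k (\<lambda>(x, y). paraboloid l x y) S"
proof -
  have "real_polynomial_function (\<lambda>p :: (real ^ 'a) \<times> (real ^ 'a). fst p $ j)"
    and "real_polynomial_function (\<lambda>p :: (real ^ 'a) \<times> (real ^ 'a). snd p $ j)" for j
    by (rule real_polynomial_function.intros(1)[OF bounded_linear_compose[OF bounded_linear_vec_nth]],
        rule bounded_linear_fst bounded_linear_snd)+
  then show ?thesis
    unfolding paraboloid_def case_prod_unfold
    by (intro Ck_on_real_polynomial_function real_polynomial_function_diff
        real_polynomial_function_sum real_polynomial_function_power) auto
qed

text \<open>The left side has the shape that differentiating the sum of squares produces. It must be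
  applied before \<open>axis_def\<close> is unfolded, hence the two simplification passes in the
  lemmas on partial derivatives.\<close>

lemma sum_axis_mult:
  fixes f :: "'d::finite \<Rightarrow> real"
  shows "(\<Sum>j\<in>A. c * (axis i 1 $ j * f j)) = (if i \<in> A then c * f i else 0)"
proof -
  have "(\<Sum>j\<in>A. c * (axis i 1 $ j * f j)) = (\<Sum>j\<in>A. if i = j then c * f j else 0)"
    by (intro sum.cong) (auto simp: axis_def)
  then show ?thesis
    by simp
qed

lemma partial_paraboloid_x:
  "partial i (\<lambda>u. paraboloid l u y) x = (if i = l then 1 else - 2 * (x $ i - y $ i))"
proof -
  have "((\<lambda>s. paraboloid l (x + s *\<^sub>R axis i 1) y) has_real_derivative
      axis i 1 $ l - (\<Sum>j\<in>UNIV - {l}. 2 * (axis i 1 $ j * (x $ j - y $ j)))) (at 0)"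
    unfolding paraboloid_def by (auto intro!: derivative_eq_intros)
  then show ?thesis
    unfolding partial_def by (simp add: DERIV_imp_deriv sum_axis_mult) (simp add: axis_def)
qed

lemma partial_paraboloid_y:
  "partial i (\<lambda>v. paraboloid l x v) y = (if i = l then - 1 else 2 * (x $ i - y $ i))"
proof -
  have "((\<lambda>s. paraboloid l x (y + s *\<^sub>R axis i 1)) has_real_derivative
      - axis i 1 $ l + (\<Sum>j\<in>UNIV - {l}. 2 * (axis i 1 $ j * (x $ j - y $ j)))) (at 0)"
    unfolding paraboloid_def by (auto intro!: derivative_eq_intros simp: sum_negf)
  then show ?thesis
    unfolding partial_def by (simp add: DERIV_imp_deriv sum_axis_mult) (simp add: axis_def)
qed

lemma mixed_hessian_paraboloid:
  "mixed_hessian (paraboloid l) x y $ i $ j = (if i = j \<and> j \<noteq> l then 2 else 0)"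
proof -
  have "((\<lambda>s. if j = l then - 1 else 2 * ((x + s *\<^sub>R axis i 1) $ j - y $ j)) has_real_derivative
      (if i = j \<and> j \<noteq> l then 2 else 0)) (at 0)"
    by (cases "j = l"; cases "i = j") (auto intro!: derivative_eq_intros simp: axis_def)
  then show ?thesis
    unfolding mixed_hessian_def partial_paraboloid_y by (simp add: partial_def DERIV_imp_deriv)
qed

text \<open>The mixed Hessian is singular, since its row and column \<open>l\<close> vanish; the
  border repairs this. For a kernel vector \<open>v\<close>, row \<open>Some l\<close> contains only
  a border entry and forces \<open>v $ None = 0\<close>. The other inner rows then give
  \<open>v $ Some i = 0\<close> for \<open>i \<noteq> l\<close>, and the border row, whose entry at
  \<open>l\<close> is 1, kills \<open>v $ Some l\<close>.\<close>

lemma det_monge_ampere_paraboloid: "det (monge_ampere_matrix (paraboloid l) x y) \<noteq> 0"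
proof -
  let ?A = "monge_ampere_matrix (paraboloid l) x y"
  have row: "(?A *v v) $ r = ?A $ r $ None * v $ None + (\<Sum>j\<in>UNIV. ?A $ r $ Some j * v $ Some j)" for v r
    by (simp add: matrix_vector_mult_def UNIV_option_conv sum.reindex)
  have "v = 0" if "?A *v v = 0" for v
  proof -
    have border: "(\<Sum>j\<in>UNIV. grad_x (paraboloid l) x y $ j * v $ Some j) = 0"
      using row[of v None] that by (simp add: monge_ampere_matrix_def)
    have inner: "- grad_y (paraboloid l) x y $ i * v $ None + (if i = l then 0 else 2 * v $ Some i) = 0" for i
    proof -
      have "(\<Sum>j\<in>UNIV. (if i = j \<and> j \<noteq> l then 2 else 0) * v $ Some j) =
          (\<Sum>j\<in>UNIV. if i = j then if i = l then 0 else 2 * v $ Some i else 0)"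
        by (intro sum.cong) auto
      then show ?thesis
        using row[of v "Some i"] that by (simp add: monge_ampere_matrix_def mixed_hessian_paraboloid)
    qed
    have none: "v $ None = 0"
      using inner[of l] by (simp add: grad_y_def partial_paraboloid_y)
    have some: "v $ Some i = 0" if "i \<noteq> l" for i
      using inner[of i] none that by simp
    have "(\<Sum>j\<in>UNIV. grad_x (paraboloid l) x y $ j * v $ Some j) = grad_x (paraboloid l) x y $ l * v $ Some l"
      using some by (subst sum.remove[of _ l]) (auto intro!: sum.neutral)
    then have "v $ Some l = 0"
      using border by (simp add: grad_x_def partial_paraboloid_x)
    with none some show ?thesis
      by (metis (no_types, lifting) option.exhaust vec_eq_iff zero_index)
  qed
  then have "invertible ?A"
    by (simp add: invertible_left_inverse matrix_left_invertible_ker)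
  then show ?thesis
    by (simp add: invertible_det_nz)
qed

section \<open>Weights and admissibility\<close>

text \<open>The factors 2 and 1 add up to \<open>d + 1\<close>, which cancels the denominator in the
  sum of the weights. The value at \<open>l\<close> is also the degree of homogeneity.\<close>

definition parabolic_weight :: "'d \<Rightarrow> 'd::finite \<Rightarrow> real" where
  "parabolic_weight l j = (if j = l then 2 else 1) * (real CARD('d) / (real CARD('d) + 1))"

lemma sum_parabolic_weight:
  fixes l :: "'d::finite"
  shows "(\<Sum>j\<in>UNIV. parabolic_weight l j) = real CARD('d)"
proof -
  have "(\<Sum>j\<in>UNIV. parabolic_weight l j) =
      (\<Sum>j\<in>UNIV. if j = l then 2 else 1) * (real CARD('d) / (real CARD('d) + 1))"
    unfolding parabolic_weight_def by (rule sum_distrib_right[symmetric])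
  also have "(\<Sum>j\<in>UNIV. if j = l then 2 else (1::real)) = real CARD('d) + 1"
    by (subst sum.remove[of _ l]) (auto simp: card_Diff_singleton of_nat_diff)
  finally show ?thesis
    by (simp add: add_nonneg_eq_0_iff)
qed

text \<open>The component \<open>l\<close> of each gradient is 1 or -1, so both are nonzero
  everywhere and the neighborhood \<open>UNIV\<close> serves. Homogeneity holds because the weight
  at \<open>l\<close> is twice each other weight, matching the squares.\<close>

lemma admissible_paraboloid:
  fixes l :: "'d::finite"
  shows "admissible (paraboloid l) (parabolic_weight l) (parabolic_weight l l)"
proof -
  have grads: "grad_x (paraboloid l) x y \<noteq> 0" "grad_y (paraboloid l) x y \<noteq> 0" for x y
    by (auto simp: vec_eq_iff grad_x_def grad_y_def partial_paraboloid_x partial_paraboloid_y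
        intro!: exI[of _ l])
  have homogeneous: "paraboloid l (dilate (parabolic_weight l) q x) (dilate (parabolic_weight l) q y) =
      q powr parabolic_weight l l * paraboloid l x y" if "q > 0" for q x y
  proof -
    have "(q powr parabolic_weight l j * x $ j - q powr parabolic_weight l j * y $ j)\<^sup>2 =
        q powr parabolic_weight l l * (x $ j - y $ j)\<^sup>2" if "j \<noteq> l" for j
    proof -
      have "(q powr parabolic_weight l j)\<^sup>2 = q powr parabolic_weight l l"
        using \<open>q > 0\<close> that by (simp add: parabolic_weight_def powr_power mult.commute)
      then show ?thesis
        by (simp add: power_mult_distrib flip: right_diff_distrib)
    qed
    then show ?thesis
      by (simp add: paraboloid_def dilate_def right_diff_distrib sum_distrib_left)
  qed
  have bounds: "0 < parabolic_weight l j" "parabolic_weight l j \<le> 2 * real CARD('d) / (real CARD('d) + 1)" for j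
    by (auto simp: parabolic_weight_def field_simps add_pos_pos)
  show ?thesis
    unfolding admissible_def
    using homogeneous bounds grads
    by (intro conjI Ck_on_paraboloid sum_parabolic_weight)
      (auto simp: det_monge_ampere_paraboloid intro!: exI[of _ UNIV])
qed

section \<open>Lattice boxes and their cardinality\<close>

text \<open>Both counting maps below overwrite coordinate \<open>l\<close>; this reads off what
  equality of two images says.\<close>

lemma replace_at_eq_iff:
  "(\<lambda>j. if j = l then a else f j) = (\<lambda>j. if j = l then b else g j) \<longleftrightarrow>
    a = b \<and> (\<forall>j. j \<noteq> l \<longrightarrow> f j = g j)"
  by (auto simp: fun_eq_iff)

text \<open>The sides depend on the coordinate, so that a single side can be exchanged by a function
  update.\<close>

definition vec_box :: "('d \<Rightarrow> 'a set) \<Rightarrow> ('a ^ 'd::finite) set" where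
  "vec_box S = {n. \<forall>j. n $ j \<in> S j}"

lemma bij_betw_vec_box: "bij_betw vec_nth (vec_box S) (Pi\<^sub>E UNIV S)"
  by (rule bij_betw_byWitness[of _ vec_lambda]) (auto simp: vec_box_def PiE_def)

lemma finite_vec_box: "(\<And>j. finite (S j)) \<Longrightarrow> finite (vec_box S)"
  using bij_betw_finite[OF bij_betw_vec_box, of S] by (simp add: finite_PiE)

lemma card_vec_box: "card (vec_box S) = (\<Prod>j\<in>UNIV. card (S j))"
  using bij_betw_same_card[OF bij_betw_vec_box, of S] by (simp add: card_PiE)

lemma lattice_box_eq: "lattice_box \<alpha> C q = vec_box (\<lambda>j. {- \<lfloor>C * q powr \<alpha> j\<rfloor>..\<lfloor>C * q powr \<alpha> j\<rfloor>})"
  unfolding lattice_box_def vec_box_def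
  by (intro Collect_cong all_cong1) (simp add: abs_le_iff le_floor_iff, linarith)

lemma finite_lattice_box_pairs:
  "finite {(n, m). n \<in> lattice_box \<alpha> C q \<and> m \<in> lattice_box \<alpha> C q \<and> P n m}"
  by (rule finite_subset[of _ "lattice_box \<alpha> C q \<times> lattice_box \<alpha> C q"])
    (auto simp: lattice_box_eq intro: finite_vec_box)

text \<open>This lets the lower bound for \<open>near_count\<close> serve the exact count
  too.\<close>

lemma exact_count_eq_near_count: "exact_count \<phi> \<alpha> \<beta> C q = near_count \<phi> \<alpha> \<beta> C q 0"
  by (simp add: exact_count_def near_count_def)

lemma prod_powr_remove1:
  fixes \<alpha> :: "'d::finite \<Rightarrow> real"
  assumes "q > 0"
  shows "(\<Prod>j\<in>UNIV - {l}. q powr \<alpha> j) = q powr ((\<Sum>j\<in>UNIV. \<alpha> j) - \<alpha> l)"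
  using assms by (simp add: sum_diff1 flip: powr_sum)

section \<open>Upper and lower bounds for the counts\<close>

text \<open>A solution is determined by its coordinates other than \<open>n $ l\<close>. This leaves
  \<open>2 * d - 1\<close> free integers, each with at most
  \<open>(2 * C + 1) * q powr \<alpha> j\<close> values.\<close>

lemma exact_count_paraboloid_le:
  fixes l :: "'d::finite"
  assumes q: "q \<ge> 1" and C: "C \<ge> 0" and \<alpha>: "\<And>j. \<alpha> j \<ge> 0"
  shows "real (exact_count (paraboloid l) \<alpha> \<beta> C q)
    \<le> (2 * C + 1) ^ (2 * CARD('d) - 1) * q powr (2 * (\<Sum>j\<in>UNIV. \<alpha> j) - \<alpha> l)"
proof -
  define S where "S j = {- \<lfloor>C * q powr \<alpha> j\<rfloor>..\<lfloor>C * q powr \<alpha> j\<rfloor>}" for j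
  define E where "E = {(n, m). n \<in> lattice_box \<alpha> C q \<and> m \<in> lattice_box \<alpha> C q \<and>
    paraboloid l (lattice_point n) (lattice_point m) = q powr \<beta>}"
  \<comment> \<open>Writing 0 into slot \<open>l\<close> forgets that coordinate and keeps the image
    in a box whose side at \<open>l\<close> has one element.\<close>
  define f :: "(int ^ 'd) \<times> (int ^ 'd) \<Rightarrow> (int ^ 'd) \<times> (int ^ 'd)"
    where "f = (\<lambda>(n, m). (\<chi> j. if j = l then 0 else n $ j, m))"
  have "inj_on f E"
  proof (rule inj_onI, clarify)
    fix n m n' m' assume mem: "(n, m) \<in> E" "(n', m') \<in> E" and "f (n, m) = f (n', m')"
    then have "m = m'" and n: "j \<noteq> l \<Longrightarrow> n $ j = n' $ j" for j
      by (auto simp: f_def replace_at_eq_iff)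
    have "(\<Sum>j\<in>UNIV - {l}. (real_of_int (n $ j) - real_of_int (m $ j))\<^sup>2) =
        (\<Sum>j\<in>UNIV - {l}. (real_of_int (n' $ j) - real_of_int (m $ j))\<^sup>2)"
      using n by (intro sum.cong) auto
    then have "n $ l = n' $ l"
      using mem \<open>m = m'\<close> by (auto simp: E_def paraboloid_def lattice_point_def)
    then have "n $ j = n' $ j" for j
      using n by (cases "j = l") auto
    then show "n = n' \<and> m = m'"
      using \<open>m = m'\<close> by (simp add: vec_eq_iff)
  qed
  moreover have "f ` E \<subseteq> vec_box (S(l := {0})) \<times> vec_box S"
    by (auto simp: f_def E_def lattice_box_eq vec_box_def S_def)
  moreover have "finite (vec_box (S(l := {0})) \<times> vec_box S)"
    by (auto simp: S_def intro!: finite_vec_box)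
  ultimately have "card E \<le> card (vec_box (S(l := {0})) \<times> vec_box S)"
    by (metis card_inj_on_le)
  also have "\<dots> = (\<Prod>j\<in>UNIV - {l}. card (S j)) * (\<Prod>j\<in>UNIV. card (S j))"
  proof -
    have "(\<Prod>j\<in>UNIV. card ((S(l := {0})) j)) = (\<Prod>j\<in>UNIV - {l}. card (S j))"
      by (subst prod.remove[of _ l]) auto
    then show ?thesis
      by (simp only: card_cartesian_product card_vec_box)
  qed
  finally have "real (card E) \<le> (\<Prod>j\<in>UNIV - {l}. real (card (S j))) * (\<Prod>j\<in>UNIV. real (card (S j)))"
    by (metis of_nat_le_iff of_nat_mult of_nat_prod)
  also have "\<dots> \<le> (\<Prod>j\<in>UNIV - {l}. (2 * C + 1) * q powr \<alpha> j) * (\<Prod>j\<in>UNIV. (2 * C + 1) * q powr \<alpha> j)"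
  proof -
    \<comment> \<open>The central point of the symmetric interval contributes 1, which
      \<open>q powr \<alpha> j \<ge> 1\<close> absorbs.\<close>
    have "real (card (S j)) \<le> (2 * C + 1) * q powr \<alpha> j" for j
    proof -
      have "real (card (S j)) = 2 * \<lfloor>C * q powr \<alpha> j\<rfloor> + 1"
        using C by (simp add: S_def)
      also have "\<dots> \<le> 2 * (C * q powr \<alpha> j) + q powr \<alpha> j"
        using ge_one_powr_ge_zero[OF q \<alpha>, of j] of_int_floor_le[of "C * q powr \<alpha> j"] by linarith
      finally show ?thesis
        by (simp add: algebra_simps)
    qed
    then show ?thesis
      using C by (intro mult_mono prod_mono) (auto intro!: prod_nonneg)
  qed
  also have "\<dots> = ((2 * C + 1) ^ (CARD('d) - 1) * (2 * C + 1) ^ CARD('d)) *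
      (q powr ((\<Sum>j\<in>UNIV. \<alpha> j) - \<alpha> l) * q powr (\<Sum>j\<in>UNIV. \<alpha> j))"
    using q by (simp add: prod.distrib prod_powr_remove1 card_Diff_singleton powr_sum)
  also have "\<dots> = (2 * C + 1) ^ (2 * CARD('d) - 1) * q powr (2 * (\<Sum>j\<in>UNIV. \<alpha> j) - \<alpha> l)"
  proof -
    have "2 * CARD('d) - 1 = (CARD('d) - 1) + CARD('d)"
      "2 * (\<Sum>j\<in>UNIV. \<alpha> j) - \<alpha> l = ((\<Sum>j\<in>UNIV. \<alpha> j) - \<alpha> l) + (\<Sum>j\<in>UNIV. \<alpha> j)"
      by simp_all
    then show ?thesis
      by (simp only: power_add powr_add)
  qed
  finally show ?thesis
    by (simp add: exact_count_def E_def)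
qed

text \<open>In the proof the parameter \<open>k = \<phi>(n, m) - q powr \<alpha> l\<close>, an integer in \<open>[0, \<delta>]\<close>, occupies
  the slot of the dependent coordinate \<open>n $ l\<close>.\<close>

lemma near_count_paraboloid_ge:
  fixes l :: "'d::finite"
  assumes q: "q \<ge> 1" and C: "C \<ge> real CARD('d) + 2"
    and \<alpha>: "\<And>j. j \<noteq> l \<Longrightarrow> 2 * \<alpha> j = \<alpha> l" and int: "q powr \<alpha> l \<in> \<int>"
    and \<delta>: "0 \<le> \<delta>" "\<delta> \<le> q powr \<alpha> l"
  shows "max 1 \<delta> * q powr (2 * (\<Sum>j\<in>UNIV. \<alpha> j) - \<alpha> l)
    \<le> real (near_count (paraboloid l) \<alpha> (\<alpha> l) C q \<delta>)"
proof -
  obtain N where N: "q powr \<alpha> l = real_of_int N"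
    using int by (auto elim: Ints_cases)
  \<comment> \<open>Only nonnegative coordinates are taken, so that a difference of two of them is
    at most \<open>q powr \<alpha> j\<close> in absolute value.\<close>
  define T where "T j = {0..\<lfloor>q powr \<alpha> j\<rfloor>}" for j
  define T' where "T' = T(l := {0..\<lfloor>\<delta>\<rfloor>})"
  define E where "E = {(n, m). n \<in> lattice_box \<alpha> C q \<and> m \<in> lattice_box \<alpha> C q \<and>
    \<bar>paraboloid l (lattice_point n) (lattice_point m) - q powr \<alpha> l\<bar> \<le> \<delta>}"
  \<comment> \<open>This is the first point's coordinate \<open>l\<close> solved from
    \<open>paraboloid = N + k\<close>, with \<open>k\<close> stored in \<open>n $ l\<close>. It is
    an integer because \<open>q powr \<alpha> l\<close> is the integer \<open>N\<close>.\<close>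
  define height where "height n m = n $ l + m $ l + N + (\<Sum>j\<in>UNIV - {l}. (n $ j - m $ j)\<^sup>2)"
    for n m :: "int ^ 'd"
  define g :: "(int ^ 'd) \<times> (int ^ 'd) \<Rightarrow> (int ^ 'd) \<times> (int ^ 'd)"
    where "g = (\<lambda>(n, m). (\<chi> j. if j = l then height n m else n $ j, m))"
  have "inj_on g (vec_box T' \<times> vec_box T)"
  proof (rule inj_onI, clarify)
    fix n m n' m' assume eq: "g (n, m) = g (n', m')"
    then have m: "m = m'" and height: "height n m = height n' m"
      and n: "j \<noteq> l \<Longrightarrow> n $ j = n' $ j" for j
      by (auto simp: g_def replace_at_eq_iff)
    have "(\<Sum>j\<in>UNIV - {l}. (n $ j - m $ j)\<^sup>2) = (\<Sum>j\<in>UNIV - {l}. (n' $ j - m $ j)\<^sup>2)"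
      using n by (intro sum.cong) auto
    then have "n $ l = n' $ l"
      using height by (simp add: height_def)
    then have "n $ j = n' $ j" for j
      using n by (cases "j = l") auto
    then show "n = n' \<and> m = m'"
      using m by (simp add: vec_eq_iff)
  qed
  moreover have "g ` (vec_box T' \<times> vec_box T) \<subseteq> E"
  proof (rule image_subsetI, clarify)
    fix n m assume "n \<in> vec_box T'" and "m \<in> vec_box T"
    then have n: "n $ j \<in> T' j" and m: "m $ j \<in> T j" for j
      by (auto simp: vec_box_def)
    have n_le: "0 \<le> n $ j" "real_of_int (n $ j) \<le> q powr \<alpha> j" if "j \<noteq> l" for j
      using n[of j] that by (auto simp: T'_def T_def le_floor_iff)
    have m_le: "0 \<le> m $ j" "real_of_int (m $ j) \<le> q powr \<alpha> j" for j
      using m[of j] by (auto simp: T_def le_floor_iff)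
    have k_le: "0 \<le> n $ l" "real_of_int (n $ l) \<le> \<delta>"
      using n[of l] by (auto simp: T'_def le_floor_iff)
    have C_ge: "q powr \<alpha> j \<le> C * q powr \<alpha> j" for j
      using C mult_right_mono[of 1 C "q powr \<alpha> j"] by simp
    have height_nonneg: "0 \<le> height n m"
      using k_le m_le N powr_ge_zero[of q "\<alpha> l"] unfolding height_def
      by (intro add_nonneg_nonneg sum_nonneg) auto
    have "(real_of_int (n $ j) - real_of_int (m $ j))\<^sup>2 \<le> q powr \<alpha> l" if "j \<noteq> l" for j
    proof -
      have "(real_of_int (n $ j) - real_of_int (m $ j))\<^sup>2 \<le> (q powr \<alpha> j)\<^sup>2"
        using n_le[OF that] m_le[of j] by (intro power2_le_iff_abs_le[THEN iffD2]) auto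
      also have "\<dots> = q powr \<alpha> l"
        using \<alpha>[OF that] q by (simp add: powr_power mult.commute)
      finally show ?thesis .
    qed
    then have "(\<Sum>j\<in>UNIV - {l}. (real_of_int (n $ j) - real_of_int (m $ j))\<^sup>2) \<le>
        real (card (UNIV - {l})) * q powr \<alpha> l"
      by (intro sum_bounded_above) auto
    also have "\<dots> = (real CARD('d) - 1) * q powr \<alpha> l"
      by (simp add: card_Diff_singleton of_nat_diff)
    \<comment> \<open>The \<open>d - 1\<close> squares, \<open>k\<close>, \<open>m $ l\<close> and
      \<open>N\<close> are each at most \<open>q powr \<alpha> l\<close>, which is the source of the
      constant \<open>d + 2\<close>.\<close>
    finally have "real_of_int (height n m) \<le> (real CARD('d) + 2) * q powr \<alpha> l"
      using k_le(2) m_le(2)[of l] \<delta>(2) N by (simp add: height_def algebra_simps)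
    also have "\<dots> \<le> C * q powr \<alpha> l"
      using C by (intro mult_right_mono) auto
    finally have "real_of_int (height n m) \<le> C * q powr \<alpha> l" .
    with height_nonneg have "fst (g (n, m)) \<in> lattice_box \<alpha> C q"
      using n_le C_ge by (auto simp: g_def lattice_box_def intro: order_trans)
    moreover have "m \<in> lattice_box \<alpha> C q"
      using m_le C_ge by (auto simp: lattice_box_def intro: order_trans)
    moreover have "paraboloid l (lattice_point (fst (g (n, m)))) (lattice_point m) - q powr \<alpha> l =
        real_of_int (n $ l)"
      using N by (simp add: paraboloid_def lattice_point_def g_def height_def)
    ultimately show "g (n, m) \<in> E"
      using k_le by (simp add: E_def g_def)
  qed
  moreover have "finite E"
    unfolding E_def by (rule finite_lattice_box_pairs)
  ultimately have "card (vec_box T' \<times> vec_box T) \<le> card E"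
    by (metis card_inj_on_le)
  moreover have "card (vec_box T' \<times> vec_box T) =
      card (T' l) * (\<Prod>j\<in>UNIV - {l}. card (T j)) * (\<Prod>j\<in>UNIV. card (T j))"
  proof -
    have "(\<Prod>j\<in>UNIV. card (T' j)) = card (T' l) * (\<Prod>j\<in>UNIV - {l}. card (T j))"
      by (subst prod.remove[of _ l]) (auto simp: T'_def)
    then show ?thesis
      by (simp only: card_cartesian_product card_vec_box)
  qed
  ultimately have "real (card (T' l)) * (\<Prod>j\<in>UNIV - {l}. real (card (T j))) * (\<Prod>j\<in>UNIV. real (card (T j)))
      \<le> real (card E)"
    by (metis of_nat_le_iff of_nat_mult of_nat_prod)
  moreover have "max 1 \<delta> * (\<Prod>j\<in>UNIV - {l}. q powr \<alpha> j) * (\<Prod>j\<in>UNIV. q powr \<alpha> j) \<le>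
      real (card (T' l)) * (\<Prod>j\<in>UNIV - {l}. real (card (T j))) * (\<Prod>j\<in>UNIV. real (card (T j)))"
  proof -
    \<comment> \<open>Since 0 is included, the interval has one element more than the floor. For
      \<delta> below 1 this still leaves the value \<open>k = 0\<close>, whence the factor
      \<open>max 1 \<delta>\<close>.\<close>
    have floor: "a \<le> real (card {0..\<lfloor>a\<rfloor>})" if "a \<ge> 0" for a :: real
      using that by simp
    have "q powr \<alpha> j \<le> real (card (T j))" for j
      unfolding T_def by (rule floor) simp
    moreover have "max 1 \<delta> \<le> real (card (T' l))"
      using floor[OF \<delta>(1)] \<delta>(1) by (simp add: T'_def)
    ultimately show ?thesis
      by (intro mult_mono prod_mono) (auto intro!: prod_nonneg mult_nonneg_nonneg)
  qed
  moreover have "(\<Prod>j\<in>UNIV - {l}. q powr \<alpha> j) * (\<Prod>j\<in>UNIV. q powr \<alpha> j) =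
      q powr (2 * (\<Sum>j\<in>UNIV. \<alpha> j) - \<alpha> l)"
    using q by (simp add: sum_diff1 flip: powr_sum powr_add)
  ultimately show ?thesis
    by (simp add: near_count_def E_def mult.assoc)
qed

section \<open>Sharpness of the exponent\<close>

text \<open>At lattice points \<phi> takes integer values, so the exact count is zero unless
  \<open>q powr \<beta>\<close> is an integer; the lower bounds are therefore restricted to such
  \<open>q\<close>, which are unbounded.\<close>

theorem mainTheorem4:
  fixes l :: "'d::finite"
    and \<phi> :: "real ^ 'd \<Rightarrow> real ^ 'd \<Rightarrow> real"
    and \<alpha> :: "'d \<Rightarrow> real"
    and d \<beta> :: real
  assumes "CARD('d) \<ge> 2"
    and "d = real CARD('d)"
    and "\<phi> = (\<lambda>x y. (x $ l - y $ l) - (\<Sum>j\<in>UNIV - {l}. (x $ j - y $ j)\<^sup>2))"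
    and "\<alpha> = (\<lambda>j. if j = l then 2 * d / (d + 1) else d / (d + 1))"
    and "\<beta> = 2 * d / (d + 1)"
  shows "admissible \<phi> \<alpha> \<beta> \<and>
    (\<exists>C\<^sub>0>0. \<forall>C\<ge>C\<^sub>0.
      (\<exists>c\<^sub>1>0. \<exists>c\<^sub>2>0. \<forall>q\<ge>1.
         q powr (- d) * real (exact_count \<phi> \<alpha> \<beta> C q) \<le> c\<^sub>2 * q powr (d - 2 + 2 / (d + 1)) \<and>
         (q powr \<beta> \<in> \<int> \<longrightarrow>
            c\<^sub>1 * q powr (d - 2 + 2 / (d + 1)) \<le> q powr (- d) * real (exact_count \<phi> \<alpha> \<beta> C q))) \<and>
      (\<exists>c>0. \<forall>q\<ge>1. q powr \<beta> \<in> \<int> \<longrightarrow> (\<forall>\<delta>\<ge>0. \<delta> \<le> q powr \<beta> \<longrightarrow>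
         c * max (q powr (d - 2 + 2 / (d + 1))) (q powr (d - \<beta>) * \<delta>)
           \<le> q powr (- d) * real (near_count \<phi> \<alpha> \<beta> C q \<delta>))) \<and>
      (\<forall>\<gamma>. lattice_bound \<phi> \<alpha> \<beta> C \<gamma> \<longrightarrow> d - 2 + 2 / (d + 1) \<le> \<gamma>))"
proof -
  define w where "w = parabolic_weight l"
  have \<phi>: "\<phi> = paraboloid l"
    by (simp add: assms(3) paraboloid_def fun_eq_iff)
  have \<alpha>: "\<alpha> = w" and \<beta>: "\<beta> = w l"
    by (auto simp: assms(2,4,5) w_def parabolic_weight_def fun_eq_iff)
  have d: "d \<ge> 2"
    using assms(1,2) by simp
  have exponent: "d - 2 + 2 / (d + 1) = d - w l"
    using d \<beta> assms(5) by (simp add: field_simps)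
  have w_nonneg: "w j \<ge> 0" and w_half: "j \<noteq> l \<Longrightarrow> 2 * w j = w l" for j
    by (simp_all add: w_def parabolic_weight_def)
  have w_pos: "w l > 0"
    using d by (simp add: assms(5) divide_pos_pos flip: \<beta>)
  have scale: "q powr (- d) * (c * q powr (2 * (\<Sum>j\<in>UNIV. w j) - w l)) = c * q powr (d - w l)" for c q
  proof -
    have "q powr (- d) * q powr (2 * (\<Sum>j\<in>UNIV. w j) - w l) = q powr (d - w l)"
      by (simp add: w_def sum_parabolic_weight assms(2) flip: powr_add)
    then show ?thesis
      by (simp add: mult.left_commute)
  qed
  have upper: "q powr (- d) * real (exact_count \<phi> \<alpha> \<beta> C q)
      \<le> (2 * C + 1) ^ (2 * CARD('d) - 1) * q powr (d - w l)" if "q \<ge> 1" "C \<ge> 0" for q C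
  proof -
    have "real (exact_count (paraboloid l) w \<beta> C q)
        \<le> (2 * C + 1) ^ (2 * CARD('d) - 1) * q powr (2 * (\<Sum>j\<in>UNIV. w j) - w l)"
      by (rule exact_count_paraboloid_le[OF that w_nonneg])
    from mult_left_mono[OF this, of "q powr (- d)"] show ?thesis
      by (simp add: \<phi> \<alpha> scale)
  qed
  have lower: "max 1 \<delta> * q powr (d - w l) \<le> q powr (- d) * real (near_count \<phi> \<alpha> \<beta> C q \<delta>)"
    if "q \<ge> 1" "C \<ge> d + 2" "q powr \<beta> \<in> \<int>" "0 \<le> \<delta>" "\<delta> \<le> q powr \<beta>" for q C \<delta>
  proof -
    have "max 1 \<delta> * q powr (2 * (\<Sum>j\<in>UNIV. w j) - w l) \<le> real (near_count (paraboloid l) w (w l) C q \<delta>)"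
      using that w_half by (intro near_count_paraboloid_ge) (simp_all add: \<beta> assms(2))
    from mult_left_mono[OF this, of "q powr (- d)"] show ?thesis
      by (simp add: \<phi> \<alpha> \<beta> scale)
  qed
  \<comment> \<open>Along \<open>q = N powr (1 / w l)\<close> and for small \<delta>, the assumed
    bound and \<open>lower\<close> give \<open>q powr (d - w l) \<le> K * q powr \<gamma>\<close>.
    This fails for large \<open>N\<close> if \<gamma> is smaller than
    \<open>d - w l\<close>.\<close>
  have sharp: "d - w l \<le> \<gamma>" if C: "C \<ge> d + 2" and bound: "lattice_bound \<phi> \<alpha> \<beta> C \<gamma>" for C \<gamma>
  proof (rule ccontr)
    assume "\<not> d - w l \<le> \<gamma>"
    then have \<epsilon>: "(d - w l - \<gamma>) / w l > 0"
      using w_pos by simp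
    obtain K where K: "K > 0" and near_le: "\<And>q \<delta>. q \<ge> 1 \<Longrightarrow> \<delta> > 0 \<Longrightarrow>
        q powr (- d) * real (near_count \<phi> \<alpha> \<beta> C q \<delta>) \<le> K * max (q powr \<gamma>) (q powr (d - \<beta>) * \<delta>)"
      using bound by (auto simp: lattice_bound_def assms(2))
    have "real N powr ((d - w l - \<gamma>) / w l) \<le> K" if N: "N \<ge> 1" for N
    proof -
      define q where "q = real N powr (1 / w l)"
      \<comment> \<open>The second entry makes the \<delta>-term of the bound at most
        \<open>q powr \<gamma>\<close>; the cap 1 ensures \<open>max 1 \<delta> = 1\<close> and
        \<open>\<delta> \<le> q powr \<beta>\<close>. A positive value is required, as
        \<open>lattice_bound\<close> excludes \<open>\<delta> = 0\<close>.\<close>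
      define \<delta> where "\<delta> = min 1 (q powr (\<gamma> - (d - w l)))"
      have q: "q \<ge> 1"
        using N w_pos by (simp add: q_def ge_one_powr_ge_zero)
      have q_pow: "q powr \<beta> = real N"
        using N w_pos by (simp add: q_def \<beta> powr_powr)
      have \<delta>: "\<delta> > 0" "\<delta> \<le> q powr \<beta>" "max 1 \<delta> = 1" "q powr (d - w l) * \<delta> \<le> q powr \<gamma>"
      proof -
        show "\<delta> > 0" "\<delta> \<le> q powr \<beta>" "max 1 \<delta> = 1"
          using q N q_pow by (auto simp: \<delta>_def)
        have "q powr (d - w l) * \<delta> \<le> q powr (d - w l) * q powr (\<gamma> - (d - w l))"
          by (intro mult_left_mono) (auto simp: \<delta>_def)
        also have "\<dots> = q powr \<gamma>"
          by (simp flip: powr_add)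
        finally show "q powr (d - w l) * \<delta> \<le> q powr \<gamma>" .
      qed
      have "q powr (d - w l) \<le> K * max (q powr \<gamma>) (q powr (d - w l) * \<delta>)"
        using lower[OF q C, of \<delta>] near_le[OF q \<delta>(1)] \<delta>(1,2,3) q_pow \<beta> by auto
      also have "\<dots> = K * q powr \<gamma>"
        using \<delta>(4) by (simp add: max_def)
      finally have "q powr (d - w l) / q powr \<gamma> \<le> K"
        using q by (simp add: divide_le_eq)
      then show ?thesis
        by (simp add: q_def powr_powr flip: powr_diff diff_divide_distrib)
    qed
    \<comment> \<open>The threshold is \<open>K\<close> raised to the reciprocal of the positive
      exponent in the preceding inequality, so that the power of \<open>N\<close> exceeds
      \<open>K\<close>.\<close>
    moreover obtain N :: nat where N: "K powr (w l / (d - w l - \<gamma>)) < real N"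
      using reals_Archimedean2 by blast
    then have "N \<ge> 1"
      by (cases N) auto
    moreover have "K < real N powr ((d - w l - \<gamma>) / w l)"
      using powr_less_mono2[OF \<epsilon> powr_ge_zero N] K w_pos \<open>\<not> d - w l \<le> \<gamma>\<close>
      by (simp add: powr_powr)
    ultimately show False
      by force
  qed
  have "admissible \<phi> \<alpha> \<beta>"
    unfolding \<phi> \<alpha> \<beta> w_def by (rule admissible_paraboloid)
  moreover have "\<exists>c\<^sub>1>0. \<exists>c\<^sub>2>0. \<forall>q\<ge>1.
      q powr (- d) * real (exact_count \<phi> \<alpha> \<beta> C q) \<le> c\<^sub>2 * q powr (d - w l) \<and>
      (q powr \<beta> \<in> \<int> \<longrightarrow>
        c\<^sub>1 * q powr (d - w l) \<le> q powr (- d) * real (exact_count \<phi> \<alpha> \<beta> C q))" if "C \<ge> d + 2" for C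
  proof (intro exI conjI allI impI)
    \<comment> \<open>The witness \<open>c\<^sub>1 = 1\<close> is the factor \<open>max 1 0\<close>
      of \<open>lower\<close> at \<open>\<delta> = 0\<close>; \<open>c\<^sub>2\<close> is the
      constant of \<open>upper\<close>.\<close>
    show "(1::real) > 0" "(2 * C + 1) ^ (2 * CARD('d) - 1) > 0"
      using that d by simp_all
  qed (use that d upper lower[of _ C 0] in \<open>auto simp: exact_count_eq_near_count\<close>)
  moreover have "\<exists>c>0. \<forall>q\<ge>1. q powr \<beta> \<in> \<int> \<longrightarrow> (\<forall>\<delta>\<ge>0. \<delta> \<le> q powr \<beta> \<longrightarrow>
      c * max (q powr (d - w l)) (q powr (d - \<beta>) * \<delta>)
        \<le> q powr (- d) * real (near_count \<phi> \<alpha> \<beta> C q \<delta>))" if "C \<ge> d + 2" for C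
  proof -
    \<comment> \<open>Since \<beta> equals \<open>w l\<close>, both entries share one power of
      \<open>q\<close>, and \<open>lower\<close> applies with constant 1.\<close>
    have "max (q powr (d - w l)) (q powr (d - \<beta>) * \<delta>) = max 1 \<delta> * q powr (d - w l)" for q \<delta>
      by (simp add: \<beta> max_mult_distrib_right mult.commute)
    then show ?thesis
      using lower that by (intro exI[of _ 1]) auto
  qed
  ultimately show ?thesis
    unfolding exponent using sharp d by (intro conjI exI[of _ "d + 2"]) auto
qed

end
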